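(* Consider the semidiscrete electroquasistatic system with circuit coupling, in the unknowns $\Phi(t)\in\mathbb{R}^{n_1}$, $v_C(t)\in\mathbb{R}^k$, $i_C(t)\in\mathbb{R}^k$: \begin{align*} Q_s^\top L_\sigma Q_s\Phi+Q_s^\top L_\varepsilon Q_s\tfrac{d}{dt}\Phi+Q_s^\top L_\sigma Y_s v_C+Q_s^\top L_\varepsilon Y_s\tfrac{d}{dt}v_C&=0,\\ Y_s^\top L_\sigma Q_s\Phi+Y_s^\top L_\varepsilon Q_s\tfrac{d}{dt}\Phi+Y_s^\top L_\sigma Y_s v_C+Y_s^\top L_\varepsilon Y_s\tfrac{d}{dt}v_C&=i_C, \end{align*} with internal variable $x_C=\Phi$. Under the assumptions listed in the context, this system is a strongly capacitance-like element.
   Context: Setting (spatial discretization of the electroquasistatic problem $\nabla\cdot\sigma\nabla\phi+\frac{d}{dt}\nabla\cdot\varepsilon\nabla\phi=0$ with homogeneous Dirichlet/Neumann conditions incorporated and terminal voltages $v_C$ prescribed on the contact boundary): $L_\sigma=\widetilde S M_\sigma\widetilde S^\top$ and $L_\varepsilon=\widetilde S M_\varepsilon\widetilde S^\top$ with $\widetilde S\in\mathbb{R}^{N\times m}$ (discrete dual divergence) such that the discrete gradient $G=-\widetilde S^\top$ has full column rank; $M_\varepsilon\in\mathbb{R}^{m\times m}$ is a symmetric positive definite permittivity matrix and $M_\sigma\in\mathbb{R}^{m\times m}$ a symmetric positive semidefinite conductivity matrix. The $N$ nodal degrees of freedom are split into those on the contact boundary and the rest: $Q_s\in\mathbb{R}^{N\times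 n_1}$ and $P_s\in\mathbb{R}^{N\times n_2}$ ($n_1+n_2=N$) are basis matrices of full column rank such that the columns of $Q_s$ and $P_s$ together are the distinct unit vectors of $\mathbb{R}^N$ (columns of $P_s$ for contact-boundary degrees of freedom). The contact boundary consists of $k$ pairwise disjoint terminals; $\Lambda_s\in\mathbb{R}^{n_2\times k}$ has entry $1$ in position $(i,j)$ if contact degree of freedom $i$ belongs to terminal $j$ and $0$ otherwise, and has full column rank; $Y_s=P_s\Lambda_s$. Definitions: a function $F(u,y)$ is strongly monotone with respect to $u$ if there is $c>0$ with $\langle F(u,y)-F(\bar u,y),u-\bar u\rangle\ge c\|u-\bar u\|^2$ for all $y,u,\bar u$. A capacitance-like element is one described by $f_C(\frac{d}{dt}d_C(x_C,i_C,v_C,t),x_C,i_C,v_C,t)=0$ such that at most one differentiation with respect to $t$ is needed to obtain $x_C'=\varphi_C(i_C',x_C,i_C,v_C,t)$, $v_C'=g_C(x_C,i_C,v_C,t)$; it is strongly capacitance-like if additionally $F_C(i_C',x_C,i_C,v_C,t):=\partial_{x_C}g_C(x_C,i_C,v_C,t)\varphi_C(i_C',x_C,i_C,v_C,t)+\partial_{i_C}g_C(x_C,i_C,v_C,t)i_C'$ is continuous and strongly monotone with respect to $i_C'$. *)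

theory Defs
  imports "HOL-Analysis.Analysis"
begin

section \<open>Generic notions: (strongly) capacitance-like elements\<close>

text \<open>An element is described by f(d/dt d(x,i,v,t), x, i, v, t) = 0,
  with internal variable x, current i and voltage v.  Arguments of f:
  the time derivative of d, then x, i, v, t.\<close>

definition ce_solution ::
  "('d::real_normed_vector \<Rightarrow> 'x::real_normed_vector \<Rightarrow> 'v::real_normed_vector \<Rightarrow> 'v \<Rightarrow> real \<Rightarrow> 'r::zero)
   \<Rightarrow> ('x \<Rightarrow> 'v \<Rightarrow> 'v \<Rightarrow> real \<Rightarrow> 'd) \<Rightarrow> real set
   \<Rightarrow> (real \<Rightarrow> 'x) \<Rightarrow> (real \<Rightarrow> 'v) \<Rightarrow> (real \<Rightarrow> 'v) \<Rightarrow> bool" where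
  "ce_solution f d J x i v \<longleftrightarrow> open J \<and>
     (\<forall>t\<in>J. x differentiable (at t) \<and> i differentiable (at t) \<and> v differentiable (at t) \<and>
        (\<lambda>s. d (x s) (i s) (v s) s) differentiable (at t) \<and>
        f (vector_derivative (\<lambda>s. d (x s) (i s) (v s) s) (at t)) (x t) (i t) (v t) t = 0)"

text \<open>Capacitance-like with witnesses phi, g: using the equations and at most one
  time differentiation, every (once differentiable) solution satisfies
  x' = phi(i', x, i, v, t) and v' = g(x, i, v, t).\<close>

definition capacitance_like_via ::
  "('d::real_normed_vector \<Rightarrow> 'x::real_normed_vector \<Rightarrow> 'v::real_normed_vector \<Rightarrow> 'v \<Rightarrow> real \<Rightarrow> 'r::zero)
   \<Rightarrow> ('x \<Rightarrow> 'v \<Rightarrow> 'v \<Rightarrow> real \<Rightarrow> 'd)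
   \<Rightarrow> ('v \<Rightarrow> 'x \<Rightarrow> 'v \<Rightarrow> 'v \<Rightarrow> real \<Rightarrow> 'x) \<Rightarrow> ('x \<Rightarrow> 'v \<Rightarrow> 'v \<Rightarrow> real \<Rightarrow> 'v) \<Rightarrow> bool" where
  "capacitance_like_via f d \<phi> g \<longleftrightarrow>
     (\<forall>J x i v. ce_solution f d J x i v \<longrightarrow>
        (\<forall>t\<in>J. vector_derivative x (at t) = \<phi> (vector_derivative i (at t)) (x t) (i t) (v t) t \<and>
               vector_derivative v (at t) = g (x t) (i t) (v t) t))"

definition capacitance_like where
  "capacitance_like f d \<longleftrightarrow> (\<exists>\<phi> g. capacitance_like_via f d \<phi> g)"

text \<open>Strong monotonicity of F(u, y) with respect to u (uniform constant c > 0).\<close>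

definition strongly_monotone_wrt_first :: "('u::real_inner \<Rightarrow> 'y \<Rightarrow> 'u) \<Rightarrow> bool" where
  "strongly_monotone_wrt_first F \<longleftrightarrow>
     (\<exists>c>0. \<forall>y u u'. inner (F u y - F u' y) (u - u') \<ge> c * (norm (u - u'))\<^sup>2)"

text \<open>Strongly capacitance-like: g has partial derivatives gx (w.r.t. x) and gi
  (w.r.t. i) everywhere, and
  F(i', x, i, v, t) = gx(x,i,v,t)(phi(i',x,i,v,t)) + gi(x,i,v,t)(i')
  is continuous and strongly monotone w.r.t. i'.\<close>

definition strongly_capacitance_like ::
  "('d::real_normed_vector \<Rightarrow> 'x::real_normed_vector \<Rightarrow> 'v::real_inner \<Rightarrow> 'v \<Rightarrow> real \<Rightarrow> 'r::zero)
   \<Rightarrow> ('x \<Rightarrow> 'v \<Rightarrow> 'v \<Rightarrow> real \<Rightarrow> 'd) \<Rightarrow> bool" where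
  "strongly_capacitance_like f d \<longleftrightarrow>
     (\<exists>\<phi> g gx gi. capacitance_like_via f d \<phi> g \<and>
        (\<forall>x i v t. ((\<lambda>x'. g x' i v t) has_derivative gx x i v t) (at x) \<and>
                   ((\<lambda>i'. g x i' v t) has_derivative gi x i v t) (at i)) \<and>
        continuous_on UNIV
          (\<lambda>(di, x, i, v, t). gx x i v t (\<phi> di x i v t) + gi x i v t di) \<and>
        strongly_monotone_wrt_first
          (\<lambda>di (x, i, v, t). gx x i v t (\<phi> di x i v t) + gi x i v t di))"

section \<open>Matrix notions\<close>

definition sym_mat :: "real^'n^'n \<Rightarrow> bool" where
  "sym_mat M \<longleftrightarrow> transpose M = M"

definition pos_def_mat :: "real^'n^'n \<Rightarrow> bool" where
  "pos_def_mat M \<longleftrightarrow> sym_mat M \<and> (\<forall>x. x \<noteq> 0 \<longrightarrow> x \<bullet> (M *v x) > 0)"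

definition pos_semidef_mat :: "real^'n^'n \<Rightarrow> bool" where
  "pos_semidef_mat M \<longleftrightarrow> sym_mat M \<and> (\<forall>x. x \<bullet> (M *v x) \<ge> 0)"

text \<open>Columns of Q and P together are the distinct unit vectors of R^N.\<close>

definition dof_split :: "real^'n1^'N \<Rightarrow> real^'n2^'N \<Rightarrow> bool" where
  "dof_split Q P \<longleftrightarrow> (\<exists>q p. inj q \<and> inj p \<and> range q \<inter> range p = {} \<and> range q \<union> range p = UNIV \<and>
      Q = (\<chi> r c. if r = q c then 1 else 0) \<and> P = (\<chi> r c. if r = p c then 1 else 0))"

text \<open>Terminal incidence matrix: 0/1 entries, each contact dof in exactly one
  terminal (terminals pairwise disjoint, covering the contact boundary).\<close>

definition terminal_incidence :: "real^'k^'n2 \<Rightarrow> bool" where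
  "terminal_incidence \<Lambda> \<longleftrightarrow> (\<forall>r c. \<Lambda> $ r $ c = 0 \<or> \<Lambda> $ r $ c = 1) \<and>
      (\<forall>r. \<exists>!c. \<Lambda> $ r $ c = 1)"

section \<open>The semidiscrete EQS element\<close>

text \<open>d_C(x,i,v,t) = (Phi, v_C) with x = Phi; f_C((Phi', v'), Phi, i, v, t) is the
  residual of the two equations.\<close>

definition eqs_d :: "real^'n1 \<Rightarrow> real^'k \<Rightarrow> real^'k \<Rightarrow> real \<Rightarrow> (real^'n1) \<times> (real^'k)" where
  "eqs_d \<Phi> i v t = (\<Phi>, v)"

definition eqs_f ::
  "real^'N^'N \<Rightarrow> real^'N^'N \<Rightarrow> real^'n1^'N \<Rightarrow> real^'k^'N
   \<Rightarrow> (real^'n1) \<times> (real^'k) \<Rightarrow> real^'n1 \<Rightarrow> real^'k \<Rightarrow> real^'k \<Rightarrow> real \<Rightarrow> (real^'n1) \<times> (real^'k)" where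
  "eqs_f L\<sigma> L\<epsilon> Q Y dd \<Phi> i v t =
     (let d\<Phi> = fst dd; dv = snd dd in
      ((transpose Q ** L\<sigma> ** Q) *v \<Phi> + (transpose Q ** L\<epsilon> ** Q) *v d\<Phi>
        + (transpose Q ** L\<sigma> ** Y) *v v + (transpose Q ** L\<epsilon> ** Y) *v dv,
       (transpose Y ** L\<sigma> ** Q) *v \<Phi> + (transpose Y ** L\<epsilon> ** Q) *v d\<Phi>
        + (transpose Y ** L\<sigma> ** Y) *v v + (transpose Y ** L\<epsilon> ** Y) *v dv - i))"

end

theory Submission
  imports Defs
begin

text \<open>Writing \<open>B = [Q Y]\<close>, the two equations say
  \<open>B\<^sup>T L\<^sub>\<epsilon> B (\<Phi>', v\<^sub>C') + B\<^sup>T L\<^sub>\<sigma> B (\<Phi>, v\<^sub>C) = (0, i\<^sub>C)\<close>.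
  Since the discrete gradient and \<open>B\<close> are injective and \<open>M\<^sub>\<epsilon>\<close> is positive definite,
  \<open>A = B\<^sup>T L\<^sub>\<epsilon> B\<close> is positive definite, so the system can be solved for
  \<open>(\<Phi>', v\<^sub>C')\<close> by applying \<open>A\<^sup>-\<^sup>1\<close>, without differentiating.  The resulting
  \<open>g\<close> is affine, and \<open>F\<close> depends on \<open>i\<^sub>C'\<close> only through the compression
  \<open>u \<mapsto> snd (A\<^sup>-\<^sup>1 (0, u))\<close>, which is positive definite because
  \<open>A\<^sup>-\<^sup>1\<close> is; in finite dimensions this gives strong monotonicity.\<close>

lemma linear_coercive:
  fixes T :: "'a::euclidean_space \<Rightarrow> 'a"
  assumes "linear T" and "\<And>u. u \<noteq> 0 \<Longrightarrow> inner (T u) u > 0"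
  shows "\<exists>c>0. \<forall>u. c * (norm u)\<^sup>2 \<le> inner (T u) u"
proof -
  have "continuous_on (sphere 0 1) (\<lambda>u. inner (T u) u)"
    using assms(1) by (intro continuous_intros linear_continuous_on) (simp add: linear_conv_bounded_linear)
  moreover have "sphere (0::'a) 1 \<noteq> {}"
    by (simp add: sphere_eq_empty)
  ultimately obtain e where e: "e \<in> sphere 0 1"
    and e_min: "\<And>w. w \<in> sphere 0 1 \<Longrightarrow> inner (T e) e \<le> inner (T w) w"
    using continuous_attains_inf[OF compact_sphere] by blast
  define c where "c = inner (T e) e"
  have "c * (norm u)\<^sup>2 \<le> inner (T u) u" for u
  proof (cases "u = 0")
    case False
    have "inner (T u) u = (norm u)\<^sup>2 * inner (T (u /\<^sub>R norm u)) (u /\<^sub>R norm u)"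
      using False by (simp add: linear_scale[OF assms(1)] power2_eq_square field_simps)
    moreover have "c \<le> inner (T (u /\<^sub>R norm u)) (u /\<^sub>R norm u)"
      unfolding c_def using False by (intro e_min) simp
    ultimately show ?thesis
      by (metis mult.commute mult_right_mono zero_le_power2)
  qed (simp add: linear_0[OF assms(1)])
  moreover have "c > 0"
    unfolding c_def using e by (intro assms(2)) auto
  ultimately show ?thesis by blast
qed

lemma strongly_monotone_wrt_first_affine:
  fixes T :: "'a::euclidean_space \<Rightarrow> 'a"
  assumes "linear T" and "\<And>u. u \<noteq> 0 \<Longrightarrow> inner (T u) u > 0"
  shows "strongly_monotone_wrt_first (\<lambda>u y. G y + T u)"
  using linear_coercive[OF assms] unfolding strongly_monotone_wrt_first_def
  by (simp add: linear_diff[OF assms(1), symmetric]) blast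

lemma capacitance_like_via_left_inverse:
  assumes "\<And>p. B (A p) = p"
    and "\<And>dd x i v t. f dd x i v t = 0 \<Longrightarrow> A dd = R x i v"
  shows "capacitance_like_via f (\<lambda>x i v t. (x, v))
           (\<lambda>di x i v t. fst (B (R x i v))) (\<lambda>x i v t. snd (B (R x i v)))"
  unfolding capacitance_like_via_def
proof (intro allI impI ballI)
  fix J x i v t
  assume "ce_solution f (\<lambda>x i v t. (x, v)) J x i v" and "t \<in> J"
  then have "x differentiable (at t)" and "v differentiable (at t)"
    and sol: "f (vector_derivative (\<lambda>s. (x s, v s)) (at t)) (x t) (i t) (v t) t = 0"
    unfolding ce_solution_def by auto
  then have "vector_derivative (\<lambda>s. (x s, v s)) (at t)
      = (vector_derivative x (at t), vector_derivative v (at t))"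
    by (intro vector_derivative_at has_vector_derivative_Pair) (simp_all add: vector_derivative_works)
  with sol have "(vector_derivative x (at t), vector_derivative v (at t))
      = B (R (x t) (i t) (v t))"
    using assms by metis
  then show "vector_derivative x (at t) = fst (B (R (x t) (i t) (v t))) \<and>
             vector_derivative v (at t) = snd (B (R (x t) (i t) (v t)))"
    by (metis fst_conv snd_conv)
qed

lemma strongly_capacitance_like_linear:
  fixes A K :: "'x::euclidean_space \<times> 'v::euclidean_space \<Rightarrow> 'x \<times> 'v"
    and f :: "'x \<times> 'v \<Rightarrow> 'x \<Rightarrow> 'v \<Rightarrow> 'v \<Rightarrow> real \<Rightarrow> 'r::zero"
  assumes "linear A" and A_pos: "\<And>p. p \<noteq> 0 \<Longrightarrow> inner p (A p) > 0"
    and "linear K"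
    and f_zero: "\<And>dd x i v t. f dd x i v t = 0 \<Longrightarrow> A dd + K (x, v) = (0, i)"
  shows "strongly_capacitance_like f (\<lambda>x i v t. (x, v))"
proof -
  have "inj A"
    using assms(1) A_pos by (metis inner_zero_right less_irrefl linear_injective_0)
  then obtain B where "linear B" and BA: "\<And>p. B (A p) = p" and AB: "\<And>q. A (B q) = q"
    using linear_injective_isomorphism[OF assms(1)] by metis
  define g where "g x i v = snd (B ((0, i) - K (x, v)))" for x i v
  define gx where "gx h = - snd (B (K (h, 0)))" for h
  define T where "T u = snd (B (0, u))" for u
  have B_lin: "bounded_linear B" and K_lin: "bounded_linear K"
    using \<open>linear B\<close> \<open>linear K\<close> by (simp_all add: linear_conv_bounded_linear)
  note B_intros = bounded_linear.has_derivative[OF B_lin] bounded_linear.continuous_on[OF B_lin]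
  note K_intros = bounded_linear.has_derivative[OF K_lin] bounded_linear.continuous_on[OF K_lin]
  have g_x: "((\<lambda>x'. g x' i v) has_derivative gx) (at x)" for x i v
    unfolding g_def gx_def
    by (rule derivative_eq_intros B_intros K_intros refl | simp add: linear_neg[OF \<open>linear B\<close>])+
  have g_i: "((\<lambda>i'. g x i' v) has_derivative T) (at i)" for x i v
    unfolding g_def T_def
    by (rule derivative_eq_intros B_intros K_intros refl | simp add: linear_0[OF \<open>linear K\<close>])+
  have T_pos: "inner (T u) u > 0" if "u \<noteq> 0" for u
  proof -
    have "B (0, u) \<noteq> 0"
      using AB[of "(0, u)"] that linear_0[OF assms(1)] by (auto simp: zero_prod_def)
    then have "inner (B (0, u)) (A (B (0, u))) > 0"
      by (rule A_pos)
    then show ?thesis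
      by (simp add: AB T_def inner_Pair_0)
  qed
  have "linear T"
    using g_i has_derivative_linear by blast
  have f_solve: "A dd = (0, i) - K (x, v)" if "f dd x i v t = 0" for dd x i v t
    using f_zero[OF that] by (simp add: eq_diff_eq)
  show ?thesis
    unfolding strongly_capacitance_like_def
  proof (intro exI conjI allI)
    show "capacitance_like_via f (\<lambda>x i v t. (x, v))
           (\<lambda>di x i v t. fst (B ((0, i) - K (x, v)))) (\<lambda>x i v t. g x i v)"
      unfolding g_def using capacitance_like_via_left_inverse[OF BA f_solve] .
    show "continuous_on UNIV (\<lambda>(di, x, i, v, t::real). gx (fst (B ((0, i) - K (x, v)))) + T di)"
      unfolding gx_def T_def case_prod_unfold
      by (intro continuous_intros B_intros K_intros)
    show "strongly_monotone_wrt_first (\<lambda>di (x, i, v, t::real). gx (fst (B ((0, i) - K (x, v)))) + T di)"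
      using strongly_monotone_wrt_first_affine[OF \<open>linear T\<close> T_pos]
      by (simp add: case_prod_unfold)
  qed (use g_x g_i in blast)+
qed

lemma inner_transpose_matrix_vector: "inner x (transpose A *v y) = inner (A *v x) (y::real^'n)"
  by (metis dot_lmul_matrix inner_commute transpose_matrix_vector)

lemma congruence_pos_def:
  fixes S :: "real^'m^'n" and M :: "real^'m^'m"
  assumes "pos_def_mat M" and "inj ((*v) (transpose S))" and "w \<noteq> 0"
  shows "0 < inner w ((S ** M ** transpose S) *v w)"
proof -
  have "transpose S *v w \<noteq> 0"
    using assms(2,3) by (metis injD matrix_vector_mult_0_right)
  then show ?thesis
    using assms(1) unfolding pos_def_mat_def
    by (simp add: matrix_vector_mul_assoc[symmetric] dot_lmul_matrix[symmetric])
qed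

lemma inj_matrix_vector_mult_uminus: "inj ((*v) (- A)) \<longleftrightarrow> inj ((*v) (A::real^'n^'m))"
proof -
  have "(- A) *v x = - (A *v x)" for x
    by (simp add: matrix_vector_mult_def vec_eq_iff sum_negf)
  then show ?thesis
    by (simp add: inj_on_def)
qed

lemma dof_split_injective:
  assumes "dof_split Q P" and "Q *v a + P *v c = 0"
  shows "a = 0 \<and> c = 0"
proof -
  obtain q p where "inj q" "inj p" and disj: "range q \<inter> range p = {}"
    and Q: "Q = (\<chi> r c. if r = q c then 1 else 0)" and P: "P = (\<chi> r c. if r = p c then 1 else 0)"
    using assms(1) unfolding dof_split_def by blast
  have qp: "q j \<noteq> p j'" for j j'
    using disj by blast
  have "(Q *v a) $ q j = a $ j" and "(P *v c) $ q j = 0" for j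
    using \<open>inj q\<close> qp
    by (auto simp: Q P matrix_vector_mult_def inj_eq mult_if_delta intro!: sum.neutral)
  moreover have "(P *v c) $ p j = c $ j" and "(Q *v a) $ p j = 0" for j
    using \<open>inj p\<close> qp[symmetric]
    by (auto simp: Q P matrix_vector_mult_def inj_eq mult_if_delta intro!: sum.neutral)
  ultimately show ?thesis
    using assms(2) by (metis vec_eq_iff zero_index vector_add_component add_0 add.right_neutral)
qed

lemma dof_split_terminals_injective:
  assumes "dof_split Q P" and "inj ((*v) \<Lambda>)" and "Q *v a + (P ** \<Lambda>) *v b = 0"
  shows "a = 0 \<and> b = 0"
proof -
  have "a = 0 \<and> \<Lambda> *v b = 0"
    using dof_split_injective[OF assms(1)] assms(3)
    by (simp add: matrix_vector_mul_assoc[symmetric])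
  then show ?thesis
    using assms(2) by (metis injD matrix_vector_mult_0_right)
qed

text \<open>\<open>block_congruence L Q Y\<close> is the operator \<open>[Q Y]\<^sup>T L [Q Y]\<close> acting on block
  vectors \<open>(a, b)\<close>.\<close>

definition block_congruence ::
  "real^'N^'N \<Rightarrow> real^'a^'N \<Rightarrow> real^'b^'N \<Rightarrow> (real^'a) \<times> (real^'b) \<Rightarrow> (real^'a) \<times> (real^'b)" where
  "block_congruence L Q Y p =
     (let w = L *v (Q *v fst p + Y *v snd p) in (transpose Q *v w, transpose Y *v w))"

lemma linear_block_congruence: "linear (block_congruence L Q Y)"
  by (rule linearI) (simp_all add: block_congruence_def Let_def algebra_simps del: transpose_matrix_vector)

lemma inner_block_congruence:
  "inner p (block_congruence L Q Y p)
     = inner (Q *v fst p + Y *v snd p) (L *v (Q *v fst p + Y *v snd p))"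
  by (cases p) (simp add: block_congruence_def Let_def inner_transpose_matrix_vector inner_add_left
      del: transpose_matrix_vector)

lemma eqs_f_block_congruence:
  "eqs_f L\<sigma> L\<epsilon> Q Y dd x i v t =
     block_congruence L\<epsilon> Q Y dd + block_congruence L\<sigma> Q Y (x, v) - (0, i)"
  unfolding eqs_f_def block_congruence_def Let_def matrix_vector_mul_assoc[symmetric]
    matrix_vector_right_distrib
  by (simp add: prod_eq_iff add_ac del: transpose_matrix_vector)

theorem proposition8:
  fixes S :: "real^'m^'N" and M\<sigma> M\<epsilon> :: "real^'m^'m"
    and Q :: "real^'n1^'N" and P :: "real^'n2^'N" and \<Lambda> :: "real^'k^'n2"
  assumes "rank (- transpose S) = CARD('N)"
    and "pos_def_mat M\<epsilon>"
    and "pos_semidef_mat M\<sigma>"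
    and "dof_split Q P"
    and "terminal_incidence \<Lambda>"
    and "rank \<Lambda> = CARD('k)"
  shows "strongly_capacitance_like
           (eqs_f (S ** M\<sigma> ** transpose S) (S ** M\<epsilon> ** transpose S) Q (P ** \<Lambda>))
           (eqs_d :: real^'n1 \<Rightarrow> real^'k \<Rightarrow> real^'k \<Rightarrow> real \<Rightarrow> (real^'n1) \<times> (real^'k))"
proof -
  \<comment> \<open>Only injectivity of \<open>\<Lambda>\<close> is needed: neither \<open>pos_semidef_mat M\<sigma>\<close> nor the 0/1
      structure of \<open>\<Lambda>\<close> enters, since \<open>L\<^sub>\<sigma>\<close> only contributes to the right-hand side of the
      solved system.\<close>
  let ?L\<sigma> = "S ** M\<sigma> ** transpose S" and ?L\<epsilon> = "S ** M\<epsilon> ** transpose S" and ?Y = "P ** \<Lambda>"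
  have "inj ((*v) (transpose S))"
    using assms(1) full_rank_injective inj_matrix_vector_mult_uminus by blast
  have "inj ((*v) \<Lambda>)"
    using assms(6) full_rank_injective by blast
  have A_pos: "0 < inner p (block_congruence ?L\<epsilon> Q ?Y p)" if "p \<noteq> 0" for p
    using that dof_split_terminals_injective[OF assms(4) \<open>inj ((*v) \<Lambda>)\<close>, of "fst p" "snd p"]
      congruence_pos_def[OF assms(2) \<open>inj ((*v) (transpose S))\<close>]
    by (cases p) (force simp: inner_block_congruence zero_prod_def)
  have f_zero: "block_congruence ?L\<epsilon> Q ?Y dd + block_congruence ?L\<sigma> Q ?Y (x, v) = (0, i)"
    if "eqs_f ?L\<sigma> ?L\<epsilon> Q ?Y dd x i v t = 0" for dd x i v t
    using that by (simp add: eqs_f_block_congruence)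
  have eqs_d_eq: "eqs_d = (\<lambda>x i v t. (x, v))"
    by (simp add: eqs_d_def fun_eq_iff)
  show ?thesis
    unfolding eqs_d_eq
    by (rule strongly_capacitance_like_linear[where K = "block_congruence ?L\<sigma> Q ?Y",
          OF linear_block_congruence A_pos linear_block_congruence f_zero])
qed

end
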